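(* For positive even integers $n_0\neq 16$, let $t(n_0)=\frac{n_0^3}{3}+\frac{15}{4}n_0^2+\frac{61}{6}n_0+8$ and $\omega(n_0)=\log_{n_0}t(n_0)$. Then the minimum of $\omega(n_0)$ over all positive even integers $n_0\neq 16$ is attained at $n_0=44$, and it equals $\omega(44)=\log_{44}36110\approx 2.773203$ (rounded to six decimal places).
   Context: The number $t(n_0)$ is the number of multiplications used by the $n_0\times n_0$ base case of a family of recursive bilinear matrix multiplication algorithms indexed by positive even integers $n_0\neq 16$. Applying the algorithm with base case $n_0$ recursively gives an $n\times n$ matrix multiplication algorithm of complexity $O(n^{\omega(n_0)})$, so $\omega(n_0)$ is called the exponent of the algorithm, and the optimal exponent of the family is the minimum of $\omega(n_0)$. *)

theory Defs
  imports Complex_Main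
begin

definition base_mults :: "nat \<Rightarrow> real" where
  "base_mults n = real n ^ 3 / 3 + 15 / 4 * real n ^ 2 + 61 / 6 * real n + 8"

definition mm_exponent :: "nat \<Rightarrow> real" where
  "mm_exponent n = log (real n) (base_mults n)"

definition admissible_base :: "nat \<Rightarrow> bool" where
  "admissible_base n \<longleftrightarrow> n > 0 \<and> even n \<and> n \<noteq> 16"

end

theory Submission
  imports Defs
begin

text \<open>
  Comparing \<open>\<omega>(n)\<close> with a constant \<open>c\<close> amounts to the sign of \<open>ln (t x) - c ln x\<close>, whose
  derivative has the sign of \<open>x t'(x) - c t(x)\<close>, a cubic with a single positive root. The constant
  \<open>c = 477/172\<close> is the fraction of least denominator strictly between \<open>\<omega>(44)\<close> and the smaller of
  \<open>\<omega>(42)\<close> and \<open>\<omega>(46)\<close>, and the root of the corresponding cubic lies strictly between 42 and 46. Hence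
  \<open>\<omega>(n) > c > \<omega>(44)\<close> follows for all other even \<open>n\<close> from the cases \<open>n = 42\<close> and \<open>n = 46\<close>.
\<close>

text \<open>Clearing the denominator leaves an inequality between powers, which exact arithmetic
  decides for concrete numbers.\<close>

lemma of_nat_divide_less_log:
  assumes "b > 1" "t > 0" "q > 0" "b ^ p < t ^ q"
  shows "real p / real q < log b t"
proof -
  have "real p < real q * log b t"
    using less_log_of_power[of b p "t ^ q"] assms by (simp add: log_nat_power)
  then show ?thesis
    using assms(3) by (simp add: field_simps)
qed

lemma log_less_of_nat_divide:
  assumes "b > 1" "t > 0" "q > 0" "t ^ q < b ^ p"
  shows "log b t < real p / real q"
proof -
  have "log b (t ^ q) < real p"
    using assms by (simp add: log_less_iff powr_realpow)
  then have "real q * log b t < real p"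
    using assms(2) by (simp add: log_nat_power)
  then show ?thesis
    using assms(3) by (simp add: field_simps)
qed

text \<open>
  Comparing \<open>b ^ P\<close> with \<open>t ^ Q\<close> directly is slow for large exponents. If \<open>m / n\<close> is already
  close to \<open>log b t\<close>, then \<open>t ^ n / b ^ m\<close> is close to 1, a short decimal \<open>a\<close> approximates it
  well, and division of \<open>Q\<close> by \<open>n\<close> leaves only the small exponents \<open>i\<close> and \<open>j\<close>.
\<close>

lemma of_nat_divide_less_log_step:
  assumes "b > 1" "t > 0" "a > 0" "n * k + i > 0"
    and step: "a * b ^ m \<le> t ^ n" and rest: "b ^ j < a ^ k * t ^ i"
  shows "real (m * k + j) / real (n * k + i) < log b t"
proof (rule of_nat_divide_less_log)
  have "b ^ (m * k + j) = (b ^ m) ^ k * b ^ j"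
    by (simp add: power_add power_mult)
  also have "\<dots> < (b ^ m) ^ k * (a ^ k * t ^ i)"
    using rest assms(1) by (intro mult_strict_left_mono) simp_all
  also have "\<dots> = (a * b ^ m) ^ k * t ^ i"
    by (simp add: power_mult_distrib)
  also have "\<dots> \<le> (t ^ n) ^ k * t ^ i"
    using step assms(1-3) by (intro mult_right_mono power_mono) simp_all
  finally show "b ^ (m * k + j) < t ^ (n * k + i)"
    by (simp add: power_add power_mult)
qed (use assms in simp_all)

lemma log_less_of_nat_divide_step:
  assumes "b > 1" "t > 0" "n * k + i > 0"
    and step: "t ^ n \<le> a * b ^ m" and rest: "a ^ k * t ^ i < b ^ j"
  shows "log b t < real (m * k + j) / real (n * k + i)"
proof (rule log_less_of_nat_divide)
  have "t ^ (n * k + i) = (t ^ n) ^ k * t ^ i"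
    by (simp add: power_add power_mult)
  also have "\<dots> \<le> (a * b ^ m) ^ k * t ^ i"
    using step assms(1,2) by (intro mult_right_mono power_mono) simp_all
  also have "\<dots> = (b ^ m) ^ k * (a ^ k * t ^ i)"
    by (simp add: power_mult_distrib)
  also have "\<dots> < (b ^ m) ^ k * b ^ j"
    using rest assms(1) by (intro mult_strict_left_mono) simp_all
  finally show "t ^ (n * k + i) < b ^ (m * k + j)"
    by (simp add: power_add power_mult)
qed (use assms in simp_all)

text \<open>Real-variable extension of \<open>base_mults\<close>, to which calculus applies.\<close>

definition mults_poly :: "real \<Rightarrow> real" where
  "mults_poly x = x ^ 3 / 3 + 15 / 4 * x ^ 2 + 61 / 6 * x + 8"

definition exponent_gap :: "real \<Rightarrow> real" where
  "exponent_gap x = ln (mults_poly x) - 477 / 172 * ln x"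

lemma base_mults_eq_mults_poly: "base_mults n = mults_poly (real n)"
  by (simp add: base_mults_def mults_poly_def)

lemma mults_poly_pos: "x > 0 \<Longrightarrow> mults_poly x > 0"
  unfolding mults_poly_def by (intro add_nonneg_pos add_nonneg_nonneg) auto

lemma mm_exponent_gt_iff:
  assumes "n \<ge> 2"
  shows "477 / 172 < mm_exponent n \<longleftrightarrow> exponent_gap (real n) > 0"
  using assms
  by (simp add: mm_exponent_def base_mults_eq_mults_poly exponent_gap_def log_def field_simps)

lemma exponent_gap_deriv:
  assumes "x > 0"
  shows "(exponent_gap has_real_derivative
    (13 / 172 * x ^ 3 - 1995 / 688 * x ^ 2 - 18605 / 1032 * x - 954 / 43) / (x * mults_poly x)) (at x)"
proof -
  have "(mults_poly has_real_derivative (x ^ 2 + 15 / 2 * x + 61 / 6)) (at x)"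
    unfolding mults_poly_def by (auto intro!: derivative_eq_intros simp: power2_eq_square)
  then have "(exponent_gap has_real_derivative
      ((x ^ 2 + 15 / 2 * x + 61 / 6) / mults_poly x - 477 / 172 / x)) (at x)"
    unfolding exponent_gap_def using assms mults_poly_pos[OF assms]
    by (auto intro!: derivative_eq_intros simp: field_simps)
  moreover have "(x ^ 2 + 15 / 2 * x + 61 / 6) / mults_poly x - 477 / 172 / x =
      (x * (x ^ 2 + 15 / 2 * x + 61 / 6) - 477 / 172 * mults_poly x) / (x * mults_poly x)"
    using assms mults_poly_pos[OF assms] by (simp add: divide_simps)
  moreover have "x * (x ^ 2 + 15 / 2 * x + 61 / 6) - 477 / 172 * mults_poly x =
      13 / 172 * x ^ 3 - 1995 / 688 * x ^ 2 - 18605 / 1032 * x - 954 / 43"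
    unfolding mults_poly_def by (simp add: algebra_simps power2_eq_square power3_eq_cube)
  ultimately show ?thesis
    by simp
qed

lemma exponent_gap_decreasing:
  assumes "0 < a" "a \<le> 42"
  shows "exponent_gap 42 \<le> exponent_gap a"
proof (rule DERIV_nonpos_imp_nonincreasing[OF assms(2)])
  fix x :: real
  assume x: "a \<le> x" "x \<le> 42"
  then have "x > 0"
    using assms by simp
  \<comment> \<open>Trading a factor \<open>x\<close> for 42 twice absorbs the cubic and then the
    quadratic term into the linear one, whose coefficient ends up negative.\<close>
  have "x ^ 3 \<le> 42 * x ^ 2" "x ^ 2 \<le> 42 * x"
    using x \<open>x > 0\<close> by (simp_all add: power2_eq_square power3_eq_cube)
  then have "13 / 172 * x ^ 3 - 1995 / 688 * x ^ 2 - 18605 / 1032 * x - 954 / 43 \<le> 0"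
    using \<open>x > 0\<close> by linarith
  then show "\<exists>y. (exponent_gap has_real_derivative y) (at x) \<and> y \<le> 0"
    using exponent_gap_deriv[OF \<open>x > 0\<close>] mults_poly_pos[OF \<open>x > 0\<close>] \<open>x > 0\<close>
    by (intro exI conjI) (auto simp: divide_nonpos_pos)
qed

lemma exponent_gap_increasing:
  assumes "46 \<le> b"
  shows "exponent_gap 46 \<le> exponent_gap b"
proof (rule DERIV_nonneg_imp_nondecreasing[OF assms])
  fix x :: real
  assume x: "46 \<le> x" "x \<le> b"
  then have "x > 0"
    by simp
  \<comment> \<open>With 46 the same trade leaves a positive linear coefficient, and
    \<open>x \<ge> 46\<close> outweighs the constant term.\<close>
  have "46 * x ^ 2 \<le> x ^ 3" "46 * x \<le> x ^ 2"
    using x by (simp_all add: power2_eq_square power3_eq_cube)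
  then have "13 / 172 * x ^ 3 - 1995 / 688 * x ^ 2 - 18605 / 1032 * x - 954 / 43 \<ge> 0"
    using x by linarith
  then show "\<exists>y. (exponent_gap has_real_derivative y) (at x) \<and> 0 \<le> y"
    using exponent_gap_deriv[OF \<open>x > 0\<close>] mults_poly_pos[OF \<open>x > 0\<close>] \<open>x > 0\<close>
    by (intro exI conjI) (auto simp: divide_nonneg_pos)
qed

lemma mm_exponent_44: "mm_exponent 44 = log 44 36110"
  by (simp add: mm_exponent_def base_mults_def)

lemma mm_exponent_42_gt: "477 / 172 < mm_exponent 42"
  \<comment> \<open>61/22 is a continued fraction convergent of 477/172, with 172 = 22 * 7 + 18 and
    477 = 61 * 7 + 50.\<close>
  using of_nat_divide_less_log_step[of 42 31746 "1.0446" 22 7 18 61 50]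
  by (simp add: power_divide mm_exponent_def base_mults_def)

lemma mm_exponent_46_gt: "477 / 172 < mm_exponent 46"
  using of_nat_divide_less_log_step[of 46 40856 "1.0456" 22 7 18 61 50]
  by (simp add: power_divide mm_exponent_def base_mults_def)

lemma mm_exponent_gt:
  assumes "even n" "n > 0" "n \<noteq> 44"
  shows "477 / 172 < mm_exponent n"
proof -
  have n: "n \<ge> 2"
    using assms by (auto elim!: evenE)
  consider "n \<le> 42" | "n \<ge> 46"
    using assms by (auto elim!: evenE) linarith
  then have "exponent_gap (real n) > 0"
  proof cases
    case 1
    then show ?thesis
      using exponent_gap_decreasing[of "real n"] mm_exponent_gt_iff[of 42] mm_exponent_42_gt assms(2)
      by simp
  next
    case 2
    then show ?thesis
      using exponent_gap_increasing[of "real n"] mm_exponent_gt_iff[of 46] mm_exponent_46_gt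
      by simp
  qed
  then show ?thesis
    using mm_exponent_gt_iff[OF n] by simp
qed

text \<open>
  The fractions 4243/1530 and 3974/1433 separate \<open>\<omega>(44)\<close> from the ends of the rounding interval.
\<close>

lemma mm_exponent_44_gt: "4243 / 1530 < mm_exponent 44"
proof -
  \<comment> \<open>Here 1530 = 22 * 69 + 12 and 4243 = 61 * 69 + 34. Rounding down after each
    eighth power keeps the decimals short.\<close>
  have pow: "(1.040378 :: real) ^ 69 = ((1.040378 ^ 8) ^ 8) * 1.040378 ^ 5"
    by (simp only: power_mult[symmetric] power_add[symmetric]) simp
  have "(1.3725 :: real) \<le> 1.040378 ^ 8"
    by (simp add: power_divide)
  then have "(1.3725 :: real) ^ 8 \<le> (1.040378 ^ 8) ^ 8"
    by (rule power_mono) simp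
  then have "(12.592 :: real) \<le> (1.040378 ^ 8) ^ 8"
    by (rule order_trans[rotated]) (simp add: power_divide)
  then have "(12.592 :: real) * 1.040378 ^ 5 * 36110 ^ 12 \<le> (1.040378 ^ 8) ^ 8 * 1.040378 ^ 5 * 36110 ^ 12"
    by (intro mult_right_mono) simp_all
  moreover have "(44 :: real) ^ 34 < 12.592 * 1.040378 ^ 5 * 36110 ^ 12"
    by (simp add: power_divide)
  ultimately have rest: "(44 :: real) ^ 34 < 1.040378 ^ 69 * 36110 ^ 12"
    unfolding pow by (rule less_le_trans[rotated])
  have step: "(1.040378 :: real) * 44 ^ 61 \<le> 36110 ^ 22"
    by simp
  show ?thesis
    using of_nat_divide_less_log_step[OF _ _ _ _ step rest] by (simp add: mm_exponent_44)
qed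

lemma mm_exponent_44_less: "mm_exponent 44 < 3974 / 1433"
proof -
  \<comment> \<open>Now 1433 = 22 * 65 + 3 and 3974 = 61 * 65 + 9, and the rounding goes up.\<close>
  have pow: "(1.04038 :: real) ^ 65 = ((1.04038 ^ 8) ^ 8) * 1.04038"
    by (simp only: power_mult[symmetric] power_Suc2[symmetric]) simp
  have "(1.04038 :: real) ^ 8 \<le> 1.3726"
    by (simp add: power_divide)
  then have "((1.04038 :: real) ^ 8) ^ 8 \<le> 1.3726 ^ 8"
    by (rule power_mono) simp
  then have "((1.04038 :: real) ^ 8) ^ 8 \<le> 12.5995"
    by (rule order_trans) (simp add: power_divide)
  then have "((1.04038 :: real) ^ 8) ^ 8 * 1.04038 * 36110 ^ 3 \<le> 12.5995 * 1.04038 * 36110 ^ 3"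
    by (intro mult_right_mono) simp_all
  moreover have "(12.5995 :: real) * 1.04038 * 36110 ^ 3 < 44 ^ 9"
    by simp
  ultimately have rest: "(1.04038 :: real) ^ 65 * 36110 ^ 3 < 44 ^ 9"
    unfolding pow by (rule le_less_trans)
  have step: "(36110 :: real) ^ 22 \<le> 1.04038 * 44 ^ 61"
    by simp
  show ?thesis
    using log_less_of_nat_divide_step[OF _ _ _ step rest] by (simp add: mm_exponent_44)
qed

theorem corollary3p6:
  shows "is_arg_min mm_exponent admissible_base 44
    \<and> mm_exponent 44 = log 44 36110
    \<and> round (10 ^ 6 * mm_exponent 44) = 2773203"
proof (intro conjI)
  show "is_arg_min mm_exponent admissible_base 44"
    unfolding is_arg_min_def
  proof (intro conjI notI)
    show "admissible_base 44"
      by (simp add: admissible_base_def)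
    assume "\<exists>n. admissible_base n \<and> mm_exponent n < mm_exponent 44"
    then obtain n where "admissible_base n" "mm_exponent n < mm_exponent 44"
      by blast
    then show False
      \<comment> \<open>Since 3974/1433 < 477/172, the upper rounding bound also puts \<omega>(44)
        below the separating constant.\<close>
      using mm_exponent_gt[of n] mm_exponent_44_less by (cases "n = 44") (auto simp: admissible_base_def)
  qed
  show "mm_exponent 44 = log 44 36110"
    by (rule mm_exponent_44)
  show "round (10 ^ 6 * mm_exponent 44) = 2773203"
    using mm_exponent_44_gt mm_exponent_44_less by (intro round_unique) simp_all
qed

end
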